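(* Let $R$ be an integral domain with field of fractions $K$, and let $p\in\beta R\setminus\{0\}$ be an ultrafilter satisfying the following three conditions: (1) for any $A\in p$ and $\ell\in\mathbb{N}$, there exist $b,g\in A$ with $\{bg^j\}_{j=0}^{\ell}\subseteq A$; (2) for any $A\in p$ and $h,s\in R\setminus\{0\}$, there exist $a,d\in R$ for which $\{hd,ha,ha+sd\}\subseteq A$; (3) for every $\alpha\in R\setminus\{0\}$, we have $\alpha R\in p$. Let $a,b,c\in R\setminus\{0\}$ and $n\in\mathbb{N}$ be such that one of $\frac{a}{c},\frac{b}{c},\frac{a+b}{c}$ is of the form $\left(\frac{u}{v}\right)^n$ for some $u,v\in R$ (with $v\ne0$). Define $$q=\begin{cases}p & \text{if } u=0,\\ \frac{u}{v}\cdot p & \text{otherwise.}\end{cases}$$ Then every $A\in q$ contains a solution of the equation $ax+by=cwz^n$, i.e. there exist $w,x,y,z\in A$ with $ax+by=cwz^n$. In particular, the equation $ax+by=cwz^n$ is partition regular over $R\setminus\{0\}$.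
   Context: $\beta R$ is the set of ultrafilters on the set $R$, and $\beta R\setminus\{0\}$ denotes the set of ultrafilters on $R$ other than the principal ultrafilter at $0$ (equivalently, ultrafilters on $R\setminus\{0\}$). For $u,v\in R\setminus\{0\}$ and $A\subseteq R$, $\frac{v}{u}A=\{r\in R : \frac{u}{v}r\in A\}$ (with $\frac{u}{v}r$ computed in $K$), and for an ultrafilter $p$ on $R$, $\frac{u}{v}\cdot p=\{A\subseteq R : \frac{v}{u}A\in p\}$. An equation is partition regular over a set $S$ if for every finite partition of $S$ some cell contains values of all the variables (not necessarily distinct) satisfying the equation. *)

theory Defs
  imports "HOL-Library.Disjoint_Sets" "HOL-Computational_Algebra.Polynomial_Factorial"
begin

definition ultrafilter :: "'a set set \<Rightarrow> bool" where
  "ultrafilter p \<longleftrightarrow>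
     UNIV \<in> p \<and> {} \<notin> p \<and>
     (\<forall>A\<in>p. \<forall>B\<in>p. A \<inter> B \<in> p) \<and>
     (\<forall>A\<in>p. \<forall>B. A \<subseteq> B \<longrightarrow> B \<in> p) \<and>
     (\<forall>A. A \<in> p \<or> - A \<in> p)"

definition principal_ultrafilter :: "'a \<Rightarrow> 'a set set" where
  "principal_ultrafilter x = {A. x \<in> A}"

(* fract_scale_set s t A is the set (s/t)A, that is, the set of those ring elements r for which
   (t/s)r, computed in the field of fractions, lies in A; it is only used for nonzero s and t. *)
definition fract_scale_set :: "'a::idom \<Rightarrow> 'a \<Rightarrow> 'a set \<Rightarrow> 'a set" where
  "fract_scale_set s t A = {r. to_fract t / to_fract s * to_fract r \<in> to_fract ` A}"

(* (u/v) . p: note that membership of A is tested on (v/u)A. *)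
definition fract_scale_ultrafilter :: "'a::idom \<Rightarrow> 'a \<Rightarrow> 'a set set \<Rightarrow> 'a set set" where
  "fract_scale_ultrafilter u v p = {A. fract_scale_set v u A \<in> p}"

(* Partition regularity over S of an equation E in four variables. *)
definition partition_regular4 ::
    "'a set \<Rightarrow> ('a \<Rightarrow> 'a \<Rightarrow> 'a \<Rightarrow> 'a \<Rightarrow> bool) \<Rightarrow> bool" where
  "partition_regular4 S E \<longleftrightarrow>
     (\<forall>P. finite P \<and> partition_on S P \<longrightarrow>
        (\<exists>C\<in>P. \<exists>w\<in>C. \<exists>x\<in>C. \<exists>y\<in>C. \<exists>z\<in>C. E w x y z))"

end

theory Submission
  imports Defs
begin

text \<open>
  The proof superposes the two configurations that conditions (1) and (2) provide.  Given
  \<open>A \<in> p\<close>, let \<open>B\<close> be the set of those elements of \<open>A\<close> that factor as \<open>w * z ^ n\<close> with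
  \<open>w, z \<in> A\<close>.  Then \<open>B \<in> p\<close>: otherwise \<open>A - B \<in> p\<close>, and condition (1) would produce
  \<open>b, g, b * g ^ n \<in> A - B\<close>, although \<open>b * g ^ n\<close> visibly belongs to \<open>B\<close>
  (\<open>factorable_part_in_ultrafilter\<close>).  So it suffices to solve the linear equation
  \<open>a * x + b * y = c * t\<close> inside every member of \<open>p\<close>: a solution inside \<open>B\<close> has
  \<open>t = w * z ^ n\<close>.

  The linear equation is solvable when one of \<open>a\<close>, \<open>b\<close>, \<open>a + b\<close> equals \<open>c\<close>, or when
  \<open>a + b = 0\<close> (\<open>linear_solution\<close>): the case \<open>a + b = c\<close> has constant solutions,
  and in the others the triple of condition (2) is a solution for suitable \<open>h\<close> and \<open>s\<close>.

  The general case reduces to this one by rescaling.  Substituting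
  \<open>(u / v) x\<close>, \<open>(u / v) y\<close>, \<open>(u / v) w\<close>, \<open>(u / v) z\<close> and clearing denominators turns the
  coefficients \<open>a, b, c\<close> into \<open>a * v ^ n, b * v ^ n, c * u ^ n\<close>, and the hypothesis that one
  of the three quotients is \<open>(u / v) ^ n\<close> says that the new coefficients are of the special
  shape.  The case \<open>u = 0\<close> needs no rescaling: for \<open>n > 0\<close> it means \<open>a + b = 0\<close>, and for
  \<open>n = 0\<close> the power is \<open>1\<close>.

  Partition regularity follows because \<open>q\<close> contains \<open>UNIV - {0}\<close>, and therefore a cell of every
  finite partition of it; condition (3) is what makes \<open>UNIV - {0}\<close> a member of the rescaled
  ultrafilter.
\<close>

section \<open>Ultrafilters\<close>

lemma ultrafilter_mono: "ultrafilter p \<Longrightarrow> A \<in> p \<Longrightarrow> A \<subseteq> B \<Longrightarrow> B \<in> p"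
  by (auto simp: ultrafilter_def)

lemma ultrafilter_Int: "ultrafilter p \<Longrightarrow> A \<in> p \<Longrightarrow> B \<in> p \<Longrightarrow> A \<inter> B \<in> p"
  by (auto simp: ultrafilter_def)

lemma ultrafilter_Compl: "ultrafilter p \<Longrightarrow> A \<notin> p \<Longrightarrow> - A \<in> p"
  by (auto simp: ultrafilter_def)

lemma ultrafilter_empty: "ultrafilter p \<Longrightarrow> {} \<notin> p"
  by (auto simp: ultrafilter_def)

lemma ultrafilter_finite_UN:
  assumes "ultrafilter p" and "finite I" and "(\<Union>i\<in>I. F i) \<in> p"
  shows "\<exists>i\<in>I. F i \<in> p"
  using assms(2,3)
proof (induction I)
  case empty
  then show ?case using ultrafilter_empty[OF assms(1)] by simp
next
  case (insert i I)
  show ?case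
  proof (cases "F i \<in> p")
    case False
    then have "- F i \<inter> (\<Union>j\<in>insert i I. F j) \<in> p"
      using insert.prems assms(1) ultrafilter_Compl ultrafilter_Int by blast
    then have "(\<Union>j\<in>I. F j) \<in> p"
      by (rule ultrafilter_mono[OF assms(1)]) auto
    then show ?thesis using insert.IH by blast
  qed simp
qed

lemma ultrafilter_nonzero_elements:
  assumes "ultrafilter p" and "p \<noteq> principal_ultrafilter x"
  shows "- {x} \<in> p"
proof (rule ccontr)
  assume "- {x} \<notin> p"
  then have x: "{x} \<in> p"
    using ultrafilter_Compl[OF assms(1), of "- {x}"] by simp
  have "A \<in> p \<longleftrightarrow> x \<in> A" for A
  proof
    assume "A \<in> p"
    then have "{x} \<inter> A \<noteq> {}"
      using x assms(1) ultrafilter_Int ultrafilter_empty by metis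
    then show "x \<in> A" by simp
  next
    assume "x \<in> A"
    then show "A \<in> p" using ultrafilter_mono[OF assms(1) x] by simp
  qed
  then show False using assms(2) by (auto simp: principal_ultrafilter_def)
qed

text \<open>
  The step that merges the multiplicative with the linear structure: the complement of the
  factorable part cannot be large, because it would contain a product of its own elements.
\<close>

lemma factorable_part_in_ultrafilter:
  fixes p :: "'a::monoid_mult set set"
  assumes "ultrafilter p"
    and geometric: "\<And>A. A \<in> p \<Longrightarrow> \<exists>b\<in>A. \<exists>g\<in>A. b * g ^ n \<in> A"
    and "A \<in> p"
  shows "{t \<in> A. \<exists>w\<in>A. \<exists>z\<in>A. t = w * z ^ n} \<in> p" (is "?B \<in> p")
proof (rule ccontr)
  assume "?B \<notin> p"
  then have "A \<inter> - ?B \<in> p"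
    using assms ultrafilter_Compl ultrafilter_Int by blast
  from geometric[OF this] show False by blast
qed

section \<open>Solutions with special coefficients\<close>

lemma linear_solution:
  fixes a b c :: "'a::idom"
  assumes linear: "\<And>h s. h \<noteq> 0 \<Longrightarrow> s \<noteq> 0 \<Longrightarrow> \<exists>e d. {h * d, h * e, h * e + s * d} \<subseteq> B"
    and "a \<noteq> 0" and "b \<noteq> 0" and "c \<noteq> 0"
    and "a = c \<or> b = c \<or> a + b = c \<or> a + b = 0"
  shows "\<exists>x\<in>B. \<exists>y\<in>B. \<exists>t\<in>B. a * x + b * y = c * t"
  using assms(5)
proof (elim disjE)
  assume "a = c"
  obtain e d where "{a * d, a * e, a * e + b * d} \<subseteq> B"
    using linear[OF \<open>a \<noteq> 0\<close> \<open>b \<noteq> 0\<close>] by blast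
  moreover have "a * (a * e) + b * (a * d) = c * (a * e + b * d)"
    using \<open>a = c\<close> by (simp add: algebra_simps)
  ultimately show ?thesis by blast
next
  assume "b = c"
  obtain e d where "{b * d, b * e, b * e + a * d} \<subseteq> B"
    using linear[OF \<open>b \<noteq> 0\<close> \<open>a \<noteq> 0\<close>] by blast
  moreover have "a * (b * d) + b * (b * e) = c * (b * e + a * d)"
    using \<open>b = c\<close> by (simp add: algebra_simps)
  ultimately show ?thesis by blast
next
  assume "a + b = c"
  obtain t where "t \<in> B" using linear[of 1 1] by auto
  moreover have "a * t + b * t = c * t" using \<open>a + b = c\<close> by (simp flip: distrib_right)
  ultimately show ?thesis by blast
next
  assume "a + b = 0"
  then have "b = - a" by (simp add: add_eq_0_iff)
  obtain e d where "{a * d, a * e, a * e + c * d} \<subseteq> B"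
    using linear[OF \<open>a \<noteq> 0\<close> \<open>c \<noteq> 0\<close>] by blast
  moreover have "a * (a * e + c * d) + b * (a * e) = c * (a * d)"
    using \<open>b = - a\<close> by (simp add: algebra_simps)
  ultimately show ?thesis by blast
qed

lemma special_solution:
  fixes p :: "'a::idom set set"
  assumes "ultrafilter p"
    and geometric: "\<And>A. A \<in> p \<Longrightarrow> \<exists>b\<in>A. \<exists>g\<in>A. b * g ^ n \<in> A"
    and linear: "\<And>A h s. A \<in> p \<Longrightarrow> h \<noteq> 0 \<Longrightarrow> s \<noteq> 0 \<Longrightarrow>
                   \<exists>e d. {h * d, h * e, h * e + s * d} \<subseteq> A"
    and "a \<noteq> 0" and "b \<noteq> 0" and "c \<noteq> 0"
    and "a = c \<or> b = c \<or> a + b = c \<or> a + b = 0"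
    and "A \<in> p"
  shows "\<exists>w\<in>A. \<exists>x\<in>A. \<exists>y\<in>A. \<exists>z\<in>A. a * x + b * y = c * w * z ^ n"
proof -
  let ?B = "{t \<in> A. \<exists>w\<in>A. \<exists>z\<in>A. t = w * z ^ n}"
  have "?B \<in> p"
    using assms(1) geometric assms(8) by (rule factorable_part_in_ultrafilter)
  from linear_solution[OF linear[OF this] assms(4-7)]
  obtain x y t where "x \<in> ?B" "y \<in> ?B" "t \<in> ?B" and eq: "a * x + b * y = c * t"
    by blast
  then obtain w z where "w \<in> A" "z \<in> A" "t = w * z ^ n" by blast
  then have "a * x + b * y = c * w * z ^ n" using eq by (simp add: mult.assoc)
  then show ?thesis
    using \<open>w \<in> A\<close> \<open>z \<in> A\<close> \<open>x \<in> ?B\<close> \<open>y \<in> ?B\<close> by blast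
qed

section \<open>Rescaling in the field of fractions\<close>

lemma in_fract_scale_set_iff:
  assumes "v \<noteq> 0"
  shows "r \<in> fract_scale_set v u A \<longleftrightarrow> (\<exists>s\<in>A. u * r = v * s)"
proof -
  have "to_fract u / to_fract v * to_fract r = to_fract s \<longleftrightarrow> u * r = v * s" for s
  proof -
    have "to_fract u / to_fract v * to_fract r = to_fract s \<longleftrightarrow>
          to_fract (u * r) = to_fract (v * s)"
      using assms by (simp add: field_simps)
    then show ?thesis by (simp only: to_fract_eq_iff)
  qed
  then show ?thesis by (auto simp: fract_scale_set_def)
qed

lemma to_fract_quotient_eq_power_iff:
  assumes "c \<noteq> 0" and "v \<noteq> 0"
  shows "to_fract a / to_fract c = (to_fract u / to_fract v) ^ n \<longleftrightarrow> a * v ^ n = c * u ^ n"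
proof -
  have to_fract_power: "to_fract (x ^ n) = to_fract x ^ n" for x :: 'a and n
    by (induction n) simp_all
  have "to_fract a / to_fract c = (to_fract u / to_fract v) ^ n \<longleftrightarrow>
        to_fract (a * v ^ n) = to_fract (c * u ^ n)"
    using assms by (simp add: to_fract_power power_divide field_simps)
  then show ?thesis by (simp only: to_fract_eq_iff)
qed

text \<open>
  Both sides of the equation acquire a power of \<open>u / v\<close>, with exponent \<open>1\<close> on the left and
  \<open>n + 1\<close> on the right; the discrepancy \<open>(u / v) ^ n\<close> goes into the coefficients.
\<close>

lemma rescaled_solution:
  fixes a b c u v :: "'a::idom"
  assumes "v \<noteq> 0"
    and scaled: "u * w = v * w'" "u * x = v * x'" "u * y = v * y'" "u * z = v * z'"
    and eq: "(a * v ^ n) * x + (b * v ^ n) * y = (c * u ^ n) * w * z ^ n"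
  shows "a * x' + b * y' = c * w' * z' ^ n"
proof -
  have "v ^ Suc n * (a * x' + b * y') = v ^ n * (a * (v * x') + b * (v * y'))"
    by (simp add: algebra_simps)
  also have "\<dots> = u * ((a * v ^ n) * x + (b * v ^ n) * y)"
    by (simp add: scaled[symmetric] algebra_simps)
  also have "\<dots> = c * (u * w) * (u * z) ^ n"
    unfolding eq by (simp add: power_mult_distrib algebra_simps)
  also have "\<dots> = v ^ Suc n * (c * w' * z' ^ n)"
    by (simp add: scaled power_mult_distrib algebra_simps)
  finally show ?thesis using assms(1) by simp
qed

section \<open>Partition regularity of the equation\<close>

theorem theorem14:
  fixes p q :: "'a::idom set set"
    and a b c u v :: 'a
    and n :: nat
  assumes "ultrafilter p" and "p \<noteq> principal_ultrafilter 0"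
    and "\<And>A (l::nat). A \<in> p \<Longrightarrow> \<exists>b\<in>A. \<exists>g\<in>A. {b * g ^ j | j. j \<le> l} \<subseteq> A"
    and "\<And>A h s. A \<in> p \<Longrightarrow> h \<noteq> 0 \<Longrightarrow> s \<noteq> 0 \<Longrightarrow>
           \<exists>a d. {h * d, h * a, h * a + s * d} \<subseteq> A"
    and "\<And>\<alpha>. \<alpha> \<noteq> 0 \<Longrightarrow> range (\<lambda>r. \<alpha> * r) \<in> p"
    and "a \<noteq> 0" and "b \<noteq> 0" and "c \<noteq> 0" and "v \<noteq> 0"
    and "to_fract a / to_fract c = (to_fract u / to_fract v) ^ n \<or>
         to_fract b / to_fract c = (to_fract u / to_fract v) ^ n \<or>
         to_fract (a + b) / to_fract c = (to_fract u / to_fract v) ^ n"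
    and "q = (if u = 0 then p else fract_scale_ultrafilter u v p)"
  shows "(\<forall>A\<in>q. \<exists>w\<in>A. \<exists>x\<in>A. \<exists>y\<in>A. \<exists>z\<in>A. a * x + b * y = c * w * z ^ n) \<and>
         partition_regular4 (UNIV - {0}) (\<lambda>w x y z. a * x + b * y = c * w * z ^ n)"
proof -
  have uf: "ultrafilter p" and v: "v \<noteq> 0" by fact+
  have geometric: "\<exists>b\<in>A. \<exists>g\<in>A. b * g ^ n \<in> A" if "A \<in> p" for A
    using assms(3)[OF that, of n] by blast
  have powers: "a * v ^ n = c * u ^ n \<or> b * v ^ n = c * u ^ n \<or> (a + b) * v ^ n = c * u ^ n"
    using assms(10) unfolding to_fract_quotient_eq_power_iff[OF \<open>c \<noteq> 0\<close> v] .
  have special: "\<exists>w\<in>A. \<exists>x\<in>A. \<exists>y\<in>A. \<exists>z\<in>A. a' * x + b' * y = c' * w * z ^ n"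
    if "a' \<noteq> 0" "b' \<noteq> 0" "c' \<noteq> 0"
      and "a' = c' \<or> b' = c' \<or> a' + b' = c' \<or> a' + b' = 0" and "A \<in> p" for a' b' c' A
    using uf geometric assms(4) that by (rule special_solution)
  have nonzero: "- {0} \<in> p"
    using assms(1,2) by (rule ultrafilter_nonzero_elements)
  have solution: "\<exists>w\<in>A. \<exists>x\<in>A. \<exists>y\<in>A. \<exists>z\<in>A. a * x + b * y = c * w * z ^ n" if "A \<in> q" for A
  proof (cases "u = 0")
    case True
    have "a = c \<or> b = c \<or> a + b = c \<or> a + b = 0"
      using powers True \<open>a \<noteq> 0\<close> \<open>b \<noteq> 0\<close> v by (cases "n = 0") (auto simp: zero_power)
    moreover have "A \<in> p" using that True assms(11) by simp
    ultimately show ?thesis by (rule special[OF assms(6-8)])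
  next
    case False
    let ?B = "fract_scale_set v u A"
    have B: "?B \<in> p"
      using that False assms(11) by (simp add: fract_scale_ultrafilter_def)
    have shape: "a * v ^ n = c * u ^ n \<or> b * v ^ n = c * u ^ n \<or>
        a * v ^ n + b * v ^ n = c * u ^ n \<or> a * v ^ n + b * v ^ n = 0"
      using powers by (auto simp: distrib_right)
    have coeffs: "a * v ^ n \<noteq> 0" "b * v ^ n \<noteq> 0" "c * u ^ n \<noteq> 0"
      using False v \<open>a \<noteq> 0\<close> \<open>b \<noteq> 0\<close> \<open>c \<noteq> 0\<close> by simp_all
    from special[OF coeffs shape B]
    obtain w x y z where "w \<in> ?B" "x \<in> ?B" "y \<in> ?B" "z \<in> ?B"
      and eq: "(a * v ^ n) * x + (b * v ^ n) * y = (c * u ^ n) * w * z ^ n"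
      by blast
    then obtain w' x' y' z' where in_A: "w' \<in> A" "x' \<in> A" "y' \<in> A" "z' \<in> A"
      and scaled: "u * w = v * w'" "u * x = v * x'" "u * y = v * y'" "u * z = v * z'"
      unfolding in_fract_scale_set_iff[OF v] by blast
    have "a * x' + b * y' = c * w' * z' ^ n"
      using v scaled eq by (rule rescaled_solution)
    then show ?thesis using in_A by blast
  qed
  have cell: "\<exists>C\<in>P. C \<in> q" if "finite P" and part: "partition_on (UNIV - {0}) P" for P
  proof (cases "u = 0")
    case True
    have "(\<Union>C\<in>P. C) \<in> p"
      using nonzero partition_onD1[OF part] by (simp add: Compl_eq_Diff_UNIV)
    then show ?thesis
      using ultrafilter_finite_UN[OF uf \<open>finite P\<close>, of "\<lambda>C. C"] True assms(11) by auto
  next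
    case False
    have "range (\<lambda>r. v * r) \<inter> - {0} \<in> p"
      using assms(5)[OF v] nonzero by (rule ultrafilter_Int[OF uf])
    moreover have "range (\<lambda>r. v * r) \<inter> - {0} \<subseteq> (\<Union>C\<in>P. fract_scale_set v u C)"
    proof
      fix t assume "t \<in> range (\<lambda>r. v * r) \<inter> - {0}"
      then obtain r where t: "t = v * r" and "v * r \<noteq> 0" by auto
      then have "u * r \<in> \<Union>P" using False partition_onD1[OF part] by auto
      then obtain C where "C \<in> P" "u * r \<in> C" by blast
      moreover have "u * t = v * (u * r)" by (simp add: t mult.left_commute)
      ultimately show "t \<in> (\<Union>C\<in>P. fract_scale_set v u C)"
        using in_fract_scale_set_iff[OF v] by blast
    qed
    ultimately have "(\<Union>C\<in>P. fract_scale_set v u C) \<in> p" by (rule ultrafilter_mono[OF uf])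
    then show ?thesis
      using ultrafilter_finite_UN[OF uf \<open>finite P\<close>] False assms(11)
      by (auto simp: fract_scale_ultrafilter_def)
  qed
  show ?thesis
    unfolding partition_regular4_def
  proof (intro conjI ballI allI impI)
    fix P :: "'a set set" assume "finite P \<and> partition_on (UNIV - {0}) P"
    then obtain C where "C \<in> P" "C \<in> q" using cell by blast
    with solution[OF \<open>C \<in> q\<close>]
    show "\<exists>C\<in>P. \<exists>w\<in>C. \<exists>x\<in>C. \<exists>y\<in>C. \<exists>z\<in>C. a * x + b * y = c * w * z ^ n"
      by (intro bexI[of _ C])
  qed (rule solution)
qed

end
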